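(* Let $X$ be a process with r.c.l.l. paths that is an $(\mathcal F_\cdot)$-semimartingale as well as a $(\mathcal G_\cdot)$-semimartingale. Let $U$ be an r.c.l.l. process that is $(\mathcal F_\cdot)$-adapted as well as $(\mathcal G_\cdot)$-adapted. Then $$(\mathcal F_\cdot)\text{-}\int U^-\,dX=(\mathcal G_\cdot)\text{-}\int U^-\,dX .$$
   Context: $(\Omega,\mathcal F,\mathsf P)$ is a complete probability space; $(\mathcal F_t)_{t\ge0}$ and $(\mathcal G_t)_{t\ge0}$ are two filtrations (not necessarily comparable), each containing all $\mathsf P$-null sets at time $0$. A prefix $(\mathcal F_\cdot)$- means "with respect to the filtration $(\mathcal F_\cdot)$". r.c.l.l. means right continuous with left limits. For an r.c.l.l. process $H$, $H^-$ is the process with $H^-(t,\omega)=\lim_{u\to t,\,u<t}H(u,\omega)$ for $t>0$ and $H^-(0,\omega)=0$. $(\mathcal F_\cdot)\text{-}\int f\,dX$ denotes the stochastic integral of the $(\mathcal F_\cdot)$-predictable process $f$ w.r.t. the $(\mathcal F_\cdot)$-semimartingale $X$, constructed with the filtration $(\mathcal F_\cdot)$ (defined for simple predictable processes and extended by continuity); similarly for $(\mathcal G_\cdot)$. Since $U^-$ is left continuous, adapted and locally bounded, both integrals are defined. *)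

theory Defs
  imports "HOL-Probability.Probability"
begin

text \<open>
  A real-valued process is a function \<open>H :: real \<Rightarrow> 'a \<Rightarrow> real\<close> (time, then sample point).
  The time axis is \<open>{0..}\<close>: values at negative times are never referred to.
\<close>

definition filtration_on :: "'a measure \<Rightarrow> (real \<Rightarrow> 'a measure) \<Rightarrow> bool" where
  "filtration_on M F \<longleftrightarrow>
     (\<forall>t\<ge>0. subalgebra M (F t)) \<and>
     (\<forall>s t. 0 \<le> s \<longrightarrow> s \<le> t \<longrightarrow> sets (F s) \<subseteq> sets (F t)) \<and>
     null_sets M \<subseteq> sets (F 0)"

definition adapted :: "(real \<Rightarrow> 'a measure) \<Rightarrow> (real \<Rightarrow> 'a \<Rightarrow> real) \<Rightarrow> bool" where
  "adapted F H \<longleftrightarrow> (\<forall>t\<ge>0. H t \<in> borel_measurable (F t))"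

definition rcll_process :: "'a measure \<Rightarrow> (real \<Rightarrow> 'a \<Rightarrow> real) \<Rightarrow> bool" where
  "rcll_process M H \<longleftrightarrow>
     (\<forall>t\<ge>0. H t \<in> borel_measurable M) \<and>
     (\<forall>\<omega>\<in>space M.
        (\<forall>t\<ge>0. continuous (at_right t) (\<lambda>u. H u \<omega>)) \<and>
        (\<forall>t>0. \<exists>l. ((\<lambda>u. H u \<omega>) \<longlongrightarrow> l) (at_left t)))"

definition left_limit_process :: "(real \<Rightarrow> 'a \<Rightarrow> real) \<Rightarrow> real \<Rightarrow> 'a \<Rightarrow> real" where
  "left_limit_process H t \<omega> = (if t > 0 then Lim (at_left t) (\<lambda>u. H u \<omega>) else 0)"

definition indistinguishable ::
    "'a measure \<Rightarrow> (real \<Rightarrow> 'a \<Rightarrow> real) \<Rightarrow> (real \<Rightarrow> 'a \<Rightarrow> real) \<Rightarrow> bool" where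
  "indistinguishable M Y Z \<longleftrightarrow> (AE \<omega> in M. \<forall>t\<ge>0. Y t \<omega> = Z t \<omega>)"


section \<open>Semimartingales\<close>

definition martingale_on ::
    "'a measure \<Rightarrow> (real \<Rightarrow> 'a measure) \<Rightarrow> (real \<Rightarrow> 'a \<Rightarrow> real) \<Rightarrow> bool" where
  "martingale_on M F N \<longleftrightarrow>
     adapted F N \<and> (\<forall>t\<ge>0. integrable M (N t)) \<and>
     (\<forall>s t. 0 \<le> s \<longrightarrow> s \<le> t \<longrightarrow> (AE \<omega> in M. real_cond_exp M (F s) (N t) \<omega> = N s \<omega>))"

definition stopped_at :: "('a \<Rightarrow> ennreal) \<Rightarrow> (real \<Rightarrow> 'a \<Rightarrow> real) \<Rightarrow> real \<Rightarrow> 'a \<Rightarrow> real" where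
  "stopped_at \<tau> H t \<omega> = H (enn2real (min (\<tau> \<omega>) (ennreal t))) \<omega>"

text \<open>
  Stopping times take values in \<open>[0, \<infinity>]\<close>.  In \<^const>\<open>stopping_time\<close> the time index has the type of
  the values, hence the reindexing by \<^const>\<open>enn2real\<close>; the index \<open>\<infinity>\<close> gives no condition, since
  \<open>\<tau> \<omega> \<le> \<infinity>\<close> always holds.
\<close>

definition local_martingale_on ::
    "'a measure \<Rightarrow> (real \<Rightarrow> 'a measure) \<Rightarrow> (real \<Rightarrow> 'a \<Rightarrow> real) \<Rightarrow> bool" where
  "local_martingale_on M F N \<longleftrightarrow>
     rcll_process M N \<and> adapted F N \<and>
     (\<exists>\<tau> :: nat \<Rightarrow> 'a \<Rightarrow> ennreal.
        (\<forall>n. stopping_time (\<lambda>s. F (enn2real s)) (\<tau> n)) \<and>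
        (AE \<omega> in M. incseq (\<lambda>n. \<tau> n \<omega>) \<and> (\<lambda>n. \<tau> n \<omega>) \<longlonglongrightarrow> \<infinity>) \<and>
        (\<forall>n. martingale_on M F (stopped_at (\<tau> n) N)))"

definition finite_variation_process ::
    "'a measure \<Rightarrow> (real \<Rightarrow> 'a measure) \<Rightarrow> (real \<Rightarrow> 'a \<Rightarrow> real) \<Rightarrow> bool" where
  "finite_variation_process M F A \<longleftrightarrow>
     rcll_process M A \<and> adapted F A \<and>
     (\<forall>\<omega>\<in>space M. \<forall>T\<ge>0. \<exists>B. \<forall>(n::nat) (s::nat \<Rightarrow> real).
        0 \<le> s 0 \<and> (\<forall>i<n. s i \<le> s (Suc i)) \<and> s n \<le> T \<longrightarrow>
        (\<Sum>i<n. \<bar>A (s (Suc i)) \<omega> - A (s i) \<omega>\<bar>) \<le> B)"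

definition semimartingale ::
    "'a measure \<Rightarrow> (real \<Rightarrow> 'a measure) \<Rightarrow> (real \<Rightarrow> 'a \<Rightarrow> real) \<Rightarrow> bool" where
  "semimartingale M F X \<longleftrightarrow>
     (\<exists>N A. local_martingale_on M F N \<and> finite_variation_process M F A \<and>
        (\<forall>t\<ge>0. \<forall>\<omega>\<in>space M. X t \<omega> = N t \<omega> + A t \<omega>))"


section \<open>Predictable integrands\<close>

definition predictable_sigma :: "'a measure \<Rightarrow> (real \<Rightarrow> 'a measure) \<Rightarrow> (real \<times> 'a) measure" where
  "predictable_sigma M F =
     sigma ({0..} \<times> space M)
       ({{0} \<times> A | A. A \<in> sets (F 0)} \<union>
        {{s<..t} \<times> A | s t A. 0 \<le> s \<and> s \<le> t \<and> A \<in> sets (F s)})"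

definition predictable ::
    "'a measure \<Rightarrow> (real \<Rightarrow> 'a measure) \<Rightarrow> (real \<Rightarrow> 'a \<Rightarrow> real) \<Rightarrow> bool" where
  "predictable M F f \<longleftrightarrow> (\<lambda>(t, \<omega>). f t \<omega>) \<in> borel_measurable (predictable_sigma M F)"

definition bounded_predictable ::
    "'a measure \<Rightarrow> (real \<Rightarrow> 'a measure) \<Rightarrow> (real \<Rightarrow> 'a \<Rightarrow> real) \<Rightarrow> bool" where
  "bounded_predictable M F f \<longleftrightarrow>
     predictable M F f \<and> (\<exists>C. \<forall>t\<ge>0. \<forall>\<omega>\<in>space M. \<bar>f t \<omega>\<bar> \<le> C)"

text \<open>
  A simple predictable process is
  \<open>V \<cdot> 1\<^bsub>{0}\<^esub> + (\<Sum>i<n. W i \<cdot> 1\<^bsub>(s i, s (i+1)]\<^esub>)\<close>, where \<open>V\<close> is bounded and \<open>\<F>\<^sub>0\<close>-measurable and \<open>W i\<close>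
  is bounded and measurable for the \<open>\<sigma>\<close>-algebra at time \<open>s i\<close>.  Its integral uses the convention
  \<open>X\<^bsub>0-\<^esub> = 0\<close>, so that the mass at time \<open>0\<close> contributes \<open>V \<cdot> X\<^sub>0\<close>.
\<close>

definition simple_data ::
    "'a measure \<Rightarrow> (real \<Rightarrow> 'a measure) \<Rightarrow> nat \<Rightarrow> (nat \<Rightarrow> real) \<Rightarrow> ('a \<Rightarrow> real) \<Rightarrow>
     (nat \<Rightarrow> 'a \<Rightarrow> real) \<Rightarrow> bool" where
  "simple_data M F n s V W \<longleftrightarrow>
     0 \<le> s 0 \<and> (\<forall>i<n. s i < s (Suc i)) \<and>
     V \<in> borel_measurable (F 0) \<and> (\<exists>C. \<forall>\<omega>\<in>space M. \<bar>V \<omega>\<bar> \<le> C) \<and>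
     (\<forall>i<n. W i \<in> borel_measurable (F (s i)) \<and> (\<exists>C. \<forall>\<omega>\<in>space M. \<bar>W i \<omega>\<bar> \<le> C))"

definition simple_process ::
    "nat \<Rightarrow> (nat \<Rightarrow> real) \<Rightarrow> ('a \<Rightarrow> real) \<Rightarrow> (nat \<Rightarrow> 'a \<Rightarrow> real) \<Rightarrow> real \<Rightarrow> 'a \<Rightarrow> real" where
  "simple_process n s V W t \<omega> =
     V \<omega> * indicator {0} t + (\<Sum>i<n. W i \<omega> * indicator {s i<..s (Suc i)} t)"

definition simple_integral ::
    "(real \<Rightarrow> 'a \<Rightarrow> real) \<Rightarrow> nat \<Rightarrow> (nat \<Rightarrow> real) \<Rightarrow> ('a \<Rightarrow> real) \<Rightarrow> (nat \<Rightarrow> 'a \<Rightarrow> real) \<Rightarrow>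
     real \<Rightarrow> 'a \<Rightarrow> real" where
  "simple_integral X n s V W t \<omega> =
     V \<omega> * X 0 \<omega> + (\<Sum>i<n. W i \<omega> * (X (min (s (Suc i)) t) \<omega> - X (min (s i) t) \<omega>))"


section \<open>The stochastic integral\<close>

text \<open>
  Uniform convergence in probability on compact time intervals.  It is applied to r.c.l.l. processes
  only, for which the event below is measurable.
\<close>

definition ucp_convergent ::
    "'a measure \<Rightarrow> (nat \<Rightarrow> real \<Rightarrow> 'a \<Rightarrow> real) \<Rightarrow> (real \<Rightarrow> 'a \<Rightarrow> real) \<Rightarrow> bool" where
  "ucp_convergent M Y Z \<longleftrightarrow>
     (\<forall>T\<ge>0. \<forall>\<epsilon>>0.
        (\<lambda>n. measure M {\<omega>\<in>space M. \<exists>t\<in>{0..T}. \<bar>Y n t \<omega> - Z t \<omega>\<bar> > \<epsilon>}) \<longlonglongrightarrow> 0)"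

text \<open>
  \<open>J\<close> is the extension by continuity of the elementary integral to all bounded predictable
  integrands: \<open>J f\<close> is (a version of) the integral process of \<open>f\<close>, and bounded pointwise convergence
  of integrands implies convergence of the integrals uniformly on compacts in probability.  By
  a monotone class argument \<open>J\<close> is unique up to indistinguishability; for a semimartingale \<open>X\<close>
  it exists.
\<close>

definition integral_extension ::
    "'a measure \<Rightarrow> (real \<Rightarrow> 'a measure) \<Rightarrow> (real \<Rightarrow> 'a \<Rightarrow> real) \<Rightarrow>
     ((real \<Rightarrow> 'a \<Rightarrow> real) \<Rightarrow> real \<Rightarrow> 'a \<Rightarrow> real) \<Rightarrow> bool" where
  "integral_extension M F X J \<longleftrightarrow>
     (\<forall>f. bounded_predictable M F f \<longrightarrow> rcll_process M (J f) \<and> adapted F (J f)) \<and>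
     (\<forall>n s V W. simple_data M F n s V W \<longrightarrow>
        indistinguishable M (J (simple_process n s V W)) (simple_integral X n s V W)) \<and>
     (\<forall>f g a b. bounded_predictable M F f \<longrightarrow> bounded_predictable M F g \<longrightarrow>
        indistinguishable M (J (\<lambda>t \<omega>. a * f t \<omega> + b * g t \<omega>)) (\<lambda>t \<omega>. a * J f t \<omega> + b * J g t \<omega>)) \<and>
     (\<forall>f g C. (\<forall>n. predictable M F (f n)) \<longrightarrow> predictable M F g \<longrightarrow>
        (\<forall>n. \<forall>t\<ge>0. \<forall>\<omega>\<in>space M. \<bar>f n t \<omega>\<bar> \<le> C) \<longrightarrow>
        (\<forall>t\<ge>0. \<forall>\<omega>\<in>space M. (\<lambda>n. f n t \<omega>) \<longlonglongrightarrow> g t \<omega>) \<longrightarrow>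
        ucp_convergent M (\<lambda>n. J (f n)) (J g))"

text \<open>
  \<open>Y\<close> is a version of the integral of the (possibly unbounded) predictable process \<open>f\<close>.  The second
  conjunct says that \<open>f\<close> is \<open>X\<close>-integrable; the integral is then the limit of the integrals of the
  truncations \<open>f \<cdot> 1\<^bsub>|f| \<le> n\<^esub>\<close>.  Versions are determined up to indistinguishability, so the stochastic
  integral is a relation rather than a function.
\<close>

definition is_stochastic_integral ::
    "'a measure \<Rightarrow> (real \<Rightarrow> 'a measure) \<Rightarrow> (real \<Rightarrow> 'a \<Rightarrow> real) \<Rightarrow> (real \<Rightarrow> 'a \<Rightarrow> real) \<Rightarrow>
     (real \<Rightarrow> 'a \<Rightarrow> real) \<Rightarrow> bool" where
  "is_stochastic_integral M F f X Y \<longleftrightarrow>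
     predictable M F f \<and> rcll_process M Y \<and> adapted F Y \<and>
     (\<exists>J. integral_extension M F X J \<and>
        (\<forall>h. (\<forall>n. bounded_predictable M F (h n)) \<longrightarrow>
             (\<forall>n. \<forall>t\<ge>0. \<forall>\<omega>\<in>space M. \<bar>h n t \<omega>\<bar> \<le> \<bar>f t \<omega>\<bar>) \<longrightarrow>
             (\<forall>t\<ge>0. \<forall>\<omega>\<in>space M. (\<lambda>n. h n t \<omega>) \<longlonglongrightarrow> 0) \<longrightarrow>
             ucp_convergent M (\<lambda>n. J (h n)) (\<lambda>t \<omega>. 0)) \<and>
        ucp_convergent M (\<lambda>n. J (\<lambda>t \<omega>. if \<bar>f t \<omega>\<bar> \<le> real n then f t \<omega> else 0)) Y)"

end

theory Submission
  imports Defs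
begin

text \<open>
  The two integrals agree because there are approximations of \<open>U\<^sup>-\<close> whose integrals do not refer to a
  filtration at all.  For \<open>C \<ge> 0\<close> clip \<open>U\<close> to \<open>[-C, C]\<close>, sample it at the dyadic points \<open>i / 2 ^ k\<close>,
  and keep each sampled value on the interval that follows its sampling time.  The resulting step
  process is simple predictable for both filtrations, since \<open>U\<close> is adapted to both, and its integral
  is the same Riemann sum, whichever filtration is used.  The sampling times approach each \<open>t > 0\<close>
  strictly from the left, so that the step processes converge boundedly to the clipped \<open>U\<^sup>-\<close>
  (\<open>dyadic_sample_tendsto\<close>), and by continuity of the integral both integrals of the clipped \<open>U\<^sup>-\<close>
  are limits of the same Riemann sums (\<open>integral_extension_clipped_unique\<close>).

  It remains to let \<open>C\<close> tend to infinity.  The integral of \<open>U\<^sup>-\<close> is the limit of the integrals of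
  \<open>U\<^sup>- \<cdot> 1\<^bsub>|U\<^sup>-| \<le> m\<^esub>\<close>, which are cut off rather than clipped.  The two truncations differ by a process
  dominated by \<open>|U\<^sup>-|\<close> that vanishes pointwise in the limit, hence by a process with integrals tending
  to \<open>0\<close> (\<open>stochastic_integral_clipped_limit\<close>).  Limits uniform on compacts in probability are unique
  up to indistinguishability, and this gives the claim.
\<close>

section \<open>Convergence uniformly on compacts in probability\<close>

lemma rcll_process_left_limit:
  assumes "rcll_process M H" "\<omega> \<in> space M" "0 < t"
  obtains l where "((\<lambda>u. H u \<omega>) \<longlongrightarrow> l) (at_left t)"
  using assms unfolding rcll_process_def by meson

lemma rcll_process_diff:
  assumes "rcll_process M H" "rcll_process M K"
  shows "rcll_process M (\<lambda>t \<omega>. H t \<omega> - K t \<omega>)"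
  unfolding rcll_process_def
proof (intro conjI allI ballI impI)
  show "(\<lambda>\<omega>. H t \<omega> - K t \<omega>) \<in> borel_measurable M" if "0 \<le> t" for t
    using assms that by (auto simp: rcll_process_def intro: borel_measurable_diff)
  show "continuous (at_right t) (\<lambda>u. H u \<omega> - K u \<omega>)" if "\<omega> \<in> space M" "0 \<le> t" for t \<omega>
    using assms that by (intro continuous_diff) (simp_all add: rcll_process_def)
  show "\<exists>l. ((\<lambda>u. H u \<omega> - K u \<omega>) \<longlongrightarrow> l) (at_left t)" if t: "\<omega> \<in> space M" "0 < t" for t \<omega>
  proof -
    obtain l where "((\<lambda>u. H u \<omega>) \<longlongrightarrow> l) (at_left t)"
      using rcll_process_left_limit[OF assms(1) t] .
    moreover obtain l' where "((\<lambda>u. K u \<omega>) \<longlongrightarrow> l') (at_left t)"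
      using rcll_process_left_limit[OF assms(2) t] .
    ultimately have "((\<lambda>u. H u \<omega> - K u \<omega>) \<longlongrightarrow> l - l') (at_left t)"
      by (rule tendsto_diff)
    then show ?thesis by (rule exI)
  qed
qed

lemma rcll_process_zero: "rcll_process M (\<lambda>t \<omega>. 0)"
  by (auto simp: rcll_process_def intro: tendsto_const)

text \<open>
  By right continuity a level that is strictly exceeded somewhere in \<open>[0, T]\<close> is exceeded at a rational time or at
  the end point \<open>T\<close>, to the right of which \<open>[0, T]\<close> contains no time.
\<close>

lemma sets_rcll_exceeds:
  assumes H: "rcll_process M H" and T: "0 \<le> T"
  shows "{\<omega>\<in>space M. \<exists>t\<in>{0..T}. \<bar>H t \<omega>\<bar> > \<epsilon>} \<in> sets M"
proof -
  define D where "D = insert T (\<rat> \<inter> {0..T})"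
  have "countable D"
    by (auto simp: D_def intro: countable_Int1 countable_rat)
  have D: "t \<in> D \<Longrightarrow> 0 \<le> t \<and> t \<le> T" for t
    using T by (auto simp: D_def)
  have dense: "\<exists>u\<in>D. \<bar>H u \<omega>\<bar> > \<epsilon>" if "\<omega> \<in> space M" "0 \<le> t" "t \<le> T" "\<bar>H t \<omega>\<bar> > \<epsilon>" for \<omega> t
  proof (cases "t = T")
    case True
    then show ?thesis using that by (auto simp: D_def)
  next
    case False
    have "((\<lambda>u. \<bar>H u \<omega>\<bar>) \<longlongrightarrow> \<bar>H t \<omega>\<bar>) (at_right t)"
      using H that by (auto simp: rcll_process_def continuous_within intro: tendsto_rabs)
    then have "eventually (\<lambda>u. \<bar>H u \<omega>\<bar> > \<epsilon>) (at_right t)"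
      using that(4) by (rule order_tendstoD)
    then obtain b where b: "b > t" "\<And>u. t < u \<Longrightarrow> u < b \<Longrightarrow> \<bar>H u \<omega>\<bar> > \<epsilon>"
      unfolding eventually_at_right_field by blast
    have "t < min b T" using b(1) that(3) False by simp
    then obtain q where "q \<in> \<rat>" "t < q" "q < min b T"
      using Rats_dense_in_real by blast
    then show ?thesis using b(2) that by (intro bexI[of _ q]) (auto simp: D_def)
  qed
  have "{\<omega>\<in>space M. \<exists>t\<in>{0..T}. \<bar>H t \<omega>\<bar> > \<epsilon>} = (\<Union>u\<in>D. {\<omega>\<in>space M. \<bar>H u \<omega>\<bar> > \<epsilon>})"
    using dense D by fastforce
  also have "\<dots> \<in> sets M"
  proof (rule sets.countable_UN''[OF \<open>countable D\<close>])
    fix u assume "u \<in> D"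
    then have [measurable]: "H u \<in> borel_measurable M"
      using H D by (auto simp: rcll_process_def)
    show "{\<omega>\<in>space M. \<bar>H u \<omega>\<bar> > \<epsilon>} \<in> sets M" by measurable
  qed
  finally show ?thesis .
qed

text \<open>
  All the convergence facts below are instances of this comparison.  It rests on the inclusion of
  the event that \<open>R\<close> exceeds \<open>\<epsilon>\<close> in the union of the events that \<open>P\<close> or \<open>Q\<close> exceeds \<open>\<epsilon> / 2\<close>.
\<close>

lemma ucp_convergent_zero_dominated:
  assumes "prob_space M"
    and P: "\<And>n. rcll_process M (P n)" "ucp_convergent M P (\<lambda>t \<omega>. 0)"
    and Q: "\<And>n. rcll_process M (Q n)" "ucp_convergent M Q (\<lambda>t \<omega>. 0)"
    and le: "\<And>n. AE \<omega> in M. \<forall>t\<ge>0. \<bar>R n t \<omega>\<bar> \<le> \<bar>P n t \<omega>\<bar> + \<bar>Q n t \<omega>\<bar>"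
  shows "ucp_convergent M R (\<lambda>t \<omega>. 0)"
  unfolding ucp_convergent_def
proof (intro allI impI)
  fix T \<epsilon> :: real assume "0 \<le> T" "0 < \<epsilon>"
  interpret prob_space M by fact
  let ?E = "\<lambda>e H. {\<omega>\<in>space M. \<exists>t\<in>{0..T}. \<bar>H t \<omega>\<bar> > e}"
  have lim: "(\<lambda>n. measure M (?E (\<epsilon>/2) (P n)) + measure M (?E (\<epsilon>/2) (Q n))) \<longlonglongrightarrow> 0 + 0"
    using P(2)[unfolded ucp_convergent_def, rule_format, of T "\<epsilon>/2"]
      Q(2)[unfolded ucp_convergent_def, rule_format, of T "\<epsilon>/2"] \<open>0 \<le> T\<close> \<open>0 < \<epsilon>\<close>
    by (intro tendsto_add) (simp_all only: diff_0_right half_gt_zero)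
  have sets: "?E (\<epsilon>/2) (P n) \<in> sets M" "?E (\<epsilon>/2) (Q n) \<in> sets M" for n
    by (rule sets_rcll_exceeds[OF P(1) \<open>0 \<le> T\<close>], rule sets_rcll_exceeds[OF Q(1) \<open>0 \<le> T\<close>])
  have bound: "measure M (?E \<epsilon> (R n)) \<le> measure M (?E (\<epsilon>/2) (P n)) + measure M (?E (\<epsilon>/2) (Q n))" for n
  proof -
    have "AE \<omega> in M. \<omega> \<in> ?E \<epsilon> (R n) \<longrightarrow> \<omega> \<in> ?E (\<epsilon>/2) (P n) \<union> ?E (\<epsilon>/2) (Q n)"
      using le[of n]
    proof eventually_elim
      fix \<omega> assume le: "\<forall>t\<ge>0. \<bar>R n t \<omega>\<bar> \<le> \<bar>P n t \<omega>\<bar> + \<bar>Q n t \<omega>\<bar>"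
      show "\<omega> \<in> ?E \<epsilon> (R n) \<longrightarrow> \<omega> \<in> ?E (\<epsilon>/2) (P n) \<union> ?E (\<epsilon>/2) (Q n)"
      proof
        assume "\<omega> \<in> ?E \<epsilon> (R n)"
        then obtain t where t: "t \<in> {0..T}" "\<epsilon> < \<bar>R n t \<omega>\<bar>" and "\<omega> \<in> space M" by blast
        then have "\<epsilon> < \<bar>P n t \<omega>\<bar> + \<bar>Q n t \<omega>\<bar>" using le by force
        then have "\<epsilon>/2 < \<bar>P n t \<omega>\<bar> \<or> \<epsilon>/2 < \<bar>Q n t \<omega>\<bar>" by linarith
        then show "\<omega> \<in> ?E (\<epsilon>/2) (P n) \<union> ?E (\<epsilon>/2) (Q n)"
          using t(1) \<open>\<omega> \<in> space M\<close> by blast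
      qed
    qed
    then have "measure M (?E \<epsilon> (R n)) \<le> measure M (?E (\<epsilon>/2) (P n) \<union> ?E (\<epsilon>/2) (Q n))"
      using sets by (intro finite_measure_mono_AE) auto
    also have "\<dots> \<le> measure M (?E (\<epsilon>/2) (P n)) + measure M (?E (\<epsilon>/2) (Q n))"
      using sets by (intro measure_Un_le) auto
    finally show ?thesis .
  qed
  have "(\<lambda>n. measure M (?E \<epsilon> (R n))) \<longlonglongrightarrow> 0"
    by (rule tendsto_sandwich[OF _ _ tendsto_const lim[unfolded add_0_left]])
      (intro always_eventually allI measure_nonneg bound)+
  then show "(\<lambda>n. measure M {\<omega>\<in>space M. \<exists>t\<in>{0..T}. \<bar>R n t \<omega> - 0\<bar> > \<epsilon>}) \<longlonglongrightarrow> 0"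
    by simp
qed

lemma ucp_convergent_iff_diff:
  "ucp_convergent M Y Z \<longleftrightarrow> ucp_convergent M (\<lambda>n t \<omega>. Y n t \<omega> - Z t \<omega>) (\<lambda>t \<omega>. 0)"
  by (simp add: ucp_convergent_def)

lemma ucp_convergent_indistinguishable_add:
  assumes "prob_space M"
    and "\<And>n. rcll_process M (Y n)" "rcll_process M Z" "ucp_convergent M Y Z"
    and "\<And>n. rcll_process M (K n)" "ucp_convergent M K (\<lambda>t \<omega>. 0)"
    and eq: "\<And>n. indistinguishable M (V n) (\<lambda>t \<omega>. Y n t \<omega> + K n t \<omega>)"
  shows "ucp_convergent M V Z"
  unfolding ucp_convergent_iff_diff[of M V Z]
proof (rule ucp_convergent_zero_dominated[OF \<open>prob_space M\<close>])
  show "rcll_process M (\<lambda>t \<omega>. Y n t \<omega> - Z t \<omega>)" "rcll_process M (K n)" for n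
    using assms by (auto intro: rcll_process_diff)
  show "ucp_convergent M (\<lambda>n t \<omega>. Y n t \<omega> - Z t \<omega>) (\<lambda>t \<omega>. 0)"
    using assms(4) ucp_convergent_iff_diff by blast
  show "AE \<omega> in M. \<forall>t\<ge>0. \<bar>V n t \<omega> - Z t \<omega>\<bar> \<le> \<bar>Y n t \<omega> - Z t \<omega>\<bar> + \<bar>K n t \<omega>\<bar>" for n
    using eq[of n] unfolding indistinguishable_def
    by eventually_elim auto
qed fact

lemma ucp_convergent_cong:
  assumes "prob_space M" "\<And>n. rcll_process M (Y n)" "rcll_process M Z" "ucp_convergent M Y Z"
    and "\<And>n. indistinguishable M (V n) (Y n)"
  shows "ucp_convergent M V Z"
proof (rule ucp_convergent_indistinguishable_add[OF assms(1-4) rcll_process_zero])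
  show "ucp_convergent M (\<lambda>n t \<omega>. 0) (\<lambda>t \<omega>. 0)"
    by (simp add: ucp_convergent_def)
  show "indistinguishable M (V n) (\<lambda>t \<omega>. Y n t \<omega> + 0)" for n
    using assms(5)[of n] by simp
qed

text \<open>
  The comparison applied to the constant sequence \<open>Y - Z\<close> shows that its exceedance events have
  probability \<open>0\<close>; countably many horizons and levels suffice.
\<close>

lemma ucp_convergent_unique:
  assumes "prob_space M" and V: "\<And>n. rcll_process M (V n)"
    and Y: "rcll_process M Y" "ucp_convergent M V Y"
    and Z: "rcll_process M Z" "ucp_convergent M V Z"
  shows "indistinguishable M Y Z"
proof -
  interpret prob_space M by fact
  let ?E = "\<lambda>T \<epsilon>. {\<omega>\<in>space M. \<exists>t\<in>{0..T}. \<bar>Y t \<omega> - Z t \<omega>\<bar> > \<epsilon>}"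
  have "ucp_convergent M (\<lambda>n t \<omega>. Y t \<omega> - Z t \<omega>) (\<lambda>t \<omega>. 0)"
  proof (rule ucp_convergent_zero_dominated[OF \<open>prob_space M\<close>])
    show "ucp_convergent M (\<lambda>n t \<omega>. V n t \<omega> - Y t \<omega>) (\<lambda>t \<omega>. 0)"
      "ucp_convergent M (\<lambda>n t \<omega>. V n t \<omega> - Z t \<omega>) (\<lambda>t \<omega>. 0)"
      using Y Z ucp_convergent_iff_diff by blast+
  qed (use V Y Z in \<open>auto intro: rcll_process_diff\<close>)
  then have "measure M (?E T \<epsilon>) = 0" if "0 \<le> T" "0 < \<epsilon>" for T \<epsilon>
    using that by (simp add: ucp_convergent_def LIMSEQ_const_iff)
  moreover have "?E T \<epsilon> \<in> sets M" if "0 \<le> T" for T \<epsilon>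
    using sets_rcll_exceeds[OF rcll_process_diff[OF Y(1) Z(1)] that] .
  ultimately have "AE \<omega> in M. \<omega> \<notin> ?E (real i) (1 / real (Suc j))" for i j
    by (intro AE_not_in) (simp add: null_sets_def emeasure_eq_measure)
  then have "AE \<omega> in M. \<forall>i j. \<omega> \<notin> ?E (real i) (1 / real (Suc j))"
    by (simp only: AE_all_countable) blast
  then show ?thesis
    unfolding indistinguishable_def
  proof (rule AE_mp, intro AE_I2 impI allI)
    fix \<omega> t assume \<omega>: "\<omega> \<in> space M" and "0 \<le> (t::real)"
      and none: "\<forall>i j. \<omega> \<notin> ?E (real i) (1 / real (Suc j))"
    show "Y t \<omega> = Z t \<omega>"
    proof (rule ccontr)
      assume "Y t \<omega> \<noteq> Z t \<omega>"
      then obtain j where "1 / real (Suc j) < \<bar>Y t \<omega> - Z t \<omega>\<bar>"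
        using reals_Archimedean[of "\<bar>Y t \<omega> - Z t \<omega>\<bar>"] by (auto simp: inverse_eq_divide)
      moreover obtain i where "t \<le> real i" using real_arch_simple by blast
      ultimately show False
        using none \<omega> \<open>0 \<le> t\<close> by (auto dest!: spec[of _ i] spec[of _ j])
    qed
  qed
qed


section \<open>Predictability of simple processes\<close>

lemma space_predictable_sigma:
  assumes "filtration_on M F"
  shows "space (predictable_sigma M F) = {0..} \<times> space M"
  unfolding predictable_sigma_def by (rule space_measure_of_conv)

lemma space_filtration: "filtration_on M F \<Longrightarrow> 0 \<le> t \<Longrightarrow> space (F t) = space M"
  by (simp add: filtration_on_def subalgebra_def)

lemma sets_predictable_sigma_generators:
  assumes "filtration_on M F"
  shows "A \<in> sets (F 0) \<Longrightarrow> {0} \<times> A \<in> sets (predictable_sigma M F)"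
    and "0 \<le> s \<Longrightarrow> s \<le> t \<Longrightarrow> A \<in> sets (F s) \<Longrightarrow> {s<..t} \<times> A \<in> sets (predictable_sigma M F)"
proof -
  have sub: "A \<subseteq> space M" if "A \<in> sets (F t)" "0 \<le> t" for A t
    using sets.sets_into_space[OF that(1)] space_filtration[OF assms that(2)] by simp
  have gen: "{{0} \<times> A | A. A \<in> sets (F 0)} \<union> {{s<..t} \<times> A | s t A. 0 \<le> s \<and> s \<le> t \<and> A \<in> sets (F s)}
      \<subseteq> Pow ({0..} \<times> space M)"
    using sub by fastforce
  show "A \<in> sets (F 0) \<Longrightarrow> {0} \<times> A \<in> sets (predictable_sigma M F)"
    and "0 \<le> s \<Longrightarrow> s \<le> t \<Longrightarrow> A \<in> sets (F s) \<Longrightarrow> {s<..t} \<times> A \<in> sets (predictable_sigma M F)"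
    unfolding predictable_sigma_def sets_measure_of[OF gen] by blast+
qed

text \<open>
  Off \<open>S\<close> the function is \<open>0\<close>.  So the preimage of a set without \<open>0\<close> is a rectangle over \<open>S\<close>, and
  the preimage of a set with \<open>0\<close> is the complement of one.  This covers both kinds of summands of a
  simple process: \<open>S\<close> is \<open>{0}\<close> or an interval \<open>(s, t]\<close>.
\<close>

lemma measurable_cylinder:
  fixes W :: "'a \<Rightarrow> real"
  assumes space: "space P = I \<times> \<Omega>" "space N = \<Omega>" "S \<subseteq> I"
    and rect: "\<And>A. A \<in> sets N \<Longrightarrow> S \<times> A \<in> sets P"
    and W: "W \<in> borel_measurable N"
  shows "(\<lambda>(t, \<omega>). W \<omega> * indicator S t) \<in> borel_measurable P"
proof (rule borel_measurableI)
  fix B :: "real set" assume "open B"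
  let ?g = "\<lambda>(t, \<omega>). W \<omega> * indicator S t"
  have WB: "S \<times> (W -` A \<inter> space N) \<in> sets P" if "A \<in> sets borel" for A
    using that W by (intro rect) (auto intro: measurable_sets)
  show "?g -` B \<inter> space P \<in> sets P"
  proof (cases "0 \<in> B")
    case True
    then have "?g -` B \<inter> space P = space P - S \<times> (W -` (- B) \<inter> space N)"
      using space by (auto simp: indicator_def split: if_splits)
    then show ?thesis using WB[of "- B"] \<open>open B\<close> by auto
  next
    case False
    have "W \<omega> * indicator S t \<in> B \<longleftrightarrow> t \<in> S \<and> W \<omega> \<in> B" for t \<omega>
      using False by (cases "t \<in> S") simp_all
    then have "?g -` B \<inter> space P = S \<times> (W -` B \<inter> space N)"
      using space by auto
    then show ?thesis using WB[of B] \<open>open B\<close> by auto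
  qed
qed

lemma predictable_simple_process:
  assumes F: "filtration_on M F" and data: "simple_data M F n s V W"
  shows "predictable M F (simple_process n s V W)"
proof -
  let ?P = "predictable_sigma M F"
  have s: "0 \<le> s i" if "i \<le> n" for i
    using that
  proof (induction i)
    case (Suc i)
    have "s i < s (Suc i)" using data Suc.prems by (simp add: simple_data_def)
    then show ?case using Suc by simp
  qed (use data in \<open>simp add: simple_data_def\<close>)
  note cylinder = measurable_cylinder[OF space_predictable_sigma[OF F] space_filtration[OF F]]
  have "(\<lambda>(t, \<omega>). V \<omega> * indicator {0} t) \<in> borel_measurable ?P"
    using data
    by (intro cylinder[of 0] sets_predictable_sigma_generators[OF F]) (auto simp: simple_data_def)
  moreover have "(\<lambda>(t, \<omega>). W i \<omega> * indicator {s i<..s (Suc i)} t) \<in> borel_measurable ?P" if "i < n" for i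
    using data that s[of i]
    by (intro cylinder[of "s i"] sets_predictable_sigma_generators[OF F])
      (auto simp: simple_data_def intro: less_imp_le)
  ultimately have "(\<lambda>x. (case x of (t, \<omega>) \<Rightarrow> V \<omega> * indicator {0} t) +
      (\<Sum>i<n. case x of (t, \<omega>) \<Rightarrow> W i \<omega> * indicator {s i<..s (Suc i)} t)) \<in> borel_measurable ?P"
    by (intro borel_measurable_add borel_measurable_sum) auto
  then show ?thesis
    unfolding predictable_def simple_process_def by (simp add: split_beta')
qed


section \<open>Dyadic sampling of a clipped process\<close>

definition clip :: "real \<Rightarrow> real \<Rightarrow> real" where
  "clip C x = max (- C) (min C x)"

lemma abs_clip_le: "0 \<le> C \<Longrightarrow> \<bar>clip C x\<bar> \<le> C"
  by (auto simp: clip_def)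

lemma tendsto_clip: "(f \<longlongrightarrow> l) A \<Longrightarrow> ((\<lambda>x. clip C (f x)) \<longlongrightarrow> clip C l) A"
  unfolding clip_def by (intro tendsto_max tendsto_min tendsto_const)

lemma measurable_clip [measurable]: "clip C \<in> borel_measurable borel"
  unfolding clip_def by measurable

text \<open>
  The mesh goes to \<open>0\<close> while the sampled range \<open>[0, k]\<close> grows to the whole time axis.  The value \<open>0\<close>
  at time \<open>0\<close> matches the convention \<open>U\<^sup>-(0) = 0\<close>.
\<close>

definition dyadic_sample :: "real \<Rightarrow> (real \<Rightarrow> 'a \<Rightarrow> real) \<Rightarrow> nat \<Rightarrow> real \<Rightarrow> 'a \<Rightarrow> real" where
  "dyadic_sample C U k =
     simple_process (k * 2 ^ k) (\<lambda>i. real i / 2 ^ k) (\<lambda>\<omega>. 0) (\<lambda>i \<omega>. clip C (U (real i / 2 ^ k) \<omega>))"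

lemma simple_data_dyadic_sample:
  assumes "adapted F U" "0 \<le> C"
  shows "simple_data M F (k * 2 ^ k) (\<lambda>i. real i / 2 ^ k) (\<lambda>\<omega>. 0) (\<lambda>i \<omega>. clip C (U (real i / 2 ^ k) \<omega>))"
proof -
  have "(\<lambda>\<omega>. clip C (U (real i / 2 ^ k) \<omega>)) \<in> borel_measurable (F (real i / 2 ^ k))" for i
  proof -
    have [measurable]: "U (real i / 2 ^ k) \<in> borel_measurable (F (real i / 2 ^ k))"
      using assms(1) by (simp add: adapted_def)
    show ?thesis by measurable
  qed
  then show ?thesis
    using assms(2) by (auto simp: simple_data_def divide_strict_right_mono intro: abs_clip_le)
qed

lemma simple_process_eq:
  assumes i: "i < n" "s i < t" "t \<le> s (Suc i)" and "0 < t" and "mono s"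
  shows "simple_process n s V W t \<omega> = W i \<omega>"
proof -
  have "t \<notin> {s j<..s (Suc j)}" if "j \<noteq> i" for j
  proof (cases "j < i")
    case True
    then have "s (Suc j) \<le> s i" using \<open>mono s\<close> by (simp add: monoD)
    then show ?thesis using i by simp
  next
    case False
    then have "s (Suc i) \<le> s j" using \<open>mono s\<close> that by (simp add: monoD)
    then show ?thesis using i by simp
  qed
  then have "(\<Sum>j<n. W j \<omega> * indicator {s j<..s (Suc j)} t) = (\<Sum>j\<in>{i}. W j \<omega> * indicator {s j<..s (Suc j)} t)"
    using i(1) by (intro sum.mono_neutral_right) auto
  then show ?thesis
    using i \<open>0 < t\<close> by (simp add: simple_process_def)
qed

lemma dyadic_sample_at_0: "dyadic_sample C U k 0 \<omega> = 0"
proof -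
  have "indicator {real i / 2 ^ k<..real (Suc i) / 2 ^ k} 0 = (0::real)" for i
    by (auto simp: indicator_def not_less)
  then show ?thesis by (simp add: dyadic_sample_def simple_process_def)
qed

lemma dyadic_sample_beyond:
  assumes "real k < t"
  shows "dyadic_sample C U k t \<omega> = 0"
proof -
  have "t \<notin> {real i / 2 ^ k<..real (Suc i) / 2 ^ k}" if "i < k * 2 ^ k" for i
  proof -
    have "real (Suc i) \<le> real (k * 2 ^ k)" using that by (intro of_nat_mono) simp
    then have "real (Suc i) / 2 ^ k \<le> real k" by (simp add: divide_le_eq)
    then show ?thesis using assms by simp
  qed
  moreover have "0 < t" using assms by simp
  ultimately show ?thesis by (simp add: dyadic_sample_def simple_process_def)
qed

lemma dyadic_sample_eq:
  assumes "0 < t" "t \<le> real k"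
  obtains r where "t - 1 / 2 ^ k \<le> r" "r < t" "dyadic_sample C U k t \<omega> = clip C (U r \<omega>)"
proof -
  \<comment> \<open>The index of the half-open dyadic interval, open on the left, that contains \<open>t\<close>.\<close>
  define i where "i = nat (\<lceil>t * 2 ^ k\<rceil> - 1)"
  have pos: "0 < t * 2 ^ k" using assms by simp
  have i: "real i = real_of_int \<lceil>t * 2 ^ k\<rceil> - 1"
    using pos by (simp add: i_def)
  have lower: "real i < t * 2 ^ k" and upper: "t * 2 ^ k \<le> real (Suc i)"
    unfolding of_nat_Suc i by linarith+
  have "real i < real (k * 2 ^ k)"
    using less_le_trans[OF lower mult_right_mono[OF assms(2), of "2 ^ k"]] by simp
  then have less: "i < k * 2 ^ k" by (simp only: of_nat_less_iff)
  have bounds: "real i / 2 ^ k < t" "t \<le> real (Suc i) / 2 ^ k"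
    using lower upper by (simp_all add: divide_less_eq le_divide_eq)
  have "dyadic_sample C U k t \<omega> = clip C (U (real i / 2 ^ k) \<omega>)"
    unfolding dyadic_sample_def
    by (rule simple_process_eq[OF less bounds assms(1)]) (auto simp: mono_def divide_right_mono)
  moreover have "t - 1 / 2 ^ k \<le> real i / 2 ^ k"
    using bounds(2) by (simp add: add_divide_distrib)
  ultimately show ?thesis using that bounds(1) by blast
qed

lemma abs_dyadic_sample_le:
  assumes "0 \<le> C" "0 \<le> t"
  shows "\<bar>dyadic_sample C U k t \<omega>\<bar> \<le> C"
proof -
  consider "t = 0" | "real k < t" | "0 < t" "t \<le> real k" using assms by linarith
  then show ?thesis
  proof cases
    case 3
    then obtain r where "dyadic_sample C U k t \<omega> = clip C (U r \<omega>)"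
      by (rule dyadic_sample_eq)
    then show ?thesis using abs_clip_le[OF assms(1)] by simp
  qed (simp_all add: assms(1) dyadic_sample_at_0 dyadic_sample_beyond)
qed

text \<open>
  The value at \<open>t\<close> is taken at a time strictly before \<open>t\<close>, which is why the limit is that of \<open>U\<close>
  from the left and not \<open>U\<close> itself.
\<close>

lemma dyadic_sample_tendsto:
  assumes U: "rcll_process M U" and "\<omega> \<in> space M" "0 \<le> t" "0 \<le> C"
  shows "(\<lambda>k. dyadic_sample C U k t \<omega>) \<longlonglongrightarrow> clip C (left_limit_process U t \<omega>)"
proof (cases "t = 0")
  case True
  then show ?thesis
    using \<open>0 \<le> C\<close> by (simp add: dyadic_sample_at_0 left_limit_process_def clip_def)
next
  case False
  then have "0 < t" using assms by simp
  then obtain l where l: "((\<lambda>u. U u \<omega>) \<longlongrightarrow> l) (at_left t)"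
    using rcll_process_left_limit[OF U \<open>\<omega> \<in> space M\<close>] by blast
  then have left: "left_limit_process U t \<omega> = l"
    using \<open>0 < t\<close> by (simp add: left_limit_process_def tendsto_Lim)
  have "\<exists>r. t - 1 / 2 ^ k \<le> r \<and> r < t \<and> (t \<le> real k \<longrightarrow> dyadic_sample C U k t \<omega> = clip C (U r \<omega>))" for k
  proof (cases "t \<le> real k")
    case True
    then show ?thesis using dyadic_sample_eq[OF \<open>0 < t\<close> True] by metis
  qed (auto intro: exI[of _ "t - 1 / 2 ^ k"])
  then obtain r where r: "\<And>k. t - 1 / 2 ^ k \<le> r k" "\<And>k. r k < t"
    "\<And>k. t \<le> real k \<Longrightarrow> dyadic_sample C U k t \<omega> = clip C (U (r k) \<omega>)"
    by metis
  have "(\<lambda>k. t - 1 / 2 ^ k) \<longlonglongrightarrow> t - 0"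
    by (intro tendsto_diff tendsto_const LIMSEQ_divide_realpow_zero) simp
  then have shift: "(\<lambda>k. t - 1 / 2 ^ k) \<longlonglongrightarrow> t" by simp
  have "r \<longlonglongrightarrow> t"
    by (rule tendsto_sandwich[OF _ _ shift tendsto_const]) (auto simp: r less_imp_le)
  then have "filterlim r (at_left t) sequentially"
    using r(2) by (auto simp: filterlim_at less_imp_neq)
  then have "(\<lambda>k. clip C (U (r k) \<omega>)) \<longlonglongrightarrow> clip C l"
    by (rule tendsto_clip[OF filterlim_compose[OF l]])
  moreover have "eventually (\<lambda>k. clip C (U (r k) \<omega>) = dyadic_sample C U k t \<omega>) sequentially"
    using eventually_ge_at_top[of "nat \<lceil>t\<rceil>"]
    by eventually_elim (simp only: nat_ceiling_le_eq r(3))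
  ultimately show ?thesis
    unfolding left by (rule Lim_transform_eventually)
qed


section \<open>Integrals of clipped and unclipped left limits\<close>

lemma predictable_comp:
  assumes "predictable M F f" "\<phi> \<in> borel_measurable borel"
  shows "predictable M F (\<lambda>t \<omega>. \<phi> (f t \<omega>))"
  using measurable_compose[OF assms[unfolded predictable_def]]
  by (simp add: predictable_def split_beta')

lemma bounded_predictable_clip:
  assumes "predictable M F f" "0 \<le> C"
  shows "bounded_predictable M F (\<lambda>t \<omega>. clip C (f t \<omega>))"
  using predictable_comp[OF assms(1) measurable_clip] abs_clip_le[OF assms(2)]
  by (auto simp: bounded_predictable_def)

lemma integral_extension_rcll:
  "integral_extension M F X J \<Longrightarrow> bounded_predictable M F f \<Longrightarrow> rcll_process M (J f)"
  by (simp add: integral_extension_def)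

lemma integral_extension_simple:
  "integral_extension M F X J \<Longrightarrow> simple_data M F n s V W \<Longrightarrow>
    indistinguishable M (J (simple_process n s V W)) (simple_integral X n s V W)"
  by (simp add: integral_extension_def)

lemma integral_extension_linear:
  assumes "integral_extension M F X J" "bounded_predictable M F f" "bounded_predictable M F g"
  shows "indistinguishable M (J (\<lambda>t \<omega>. a * f t \<omega> + b * g t \<omega>)) (\<lambda>t \<omega>. a * J f t \<omega> + b * J g t \<omega>)"
proof -
  have "\<forall>f g a b. bounded_predictable M F f \<longrightarrow> bounded_predictable M F g \<longrightarrow>
    indistinguishable M (J (\<lambda>t \<omega>. a * f t \<omega> + b * g t \<omega>)) (\<lambda>t \<omega>. a * J f t \<omega> + b * J g t \<omega>)"
    using assms(1) unfolding integral_extension_def by (elim conjE)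
  then show ?thesis using assms(2,3) by simp
qed

lemma integral_extension_bounded_limit:
  assumes "integral_extension M F X J" "\<And>n. predictable M F (f n)" "predictable M F g"
    and "\<And>n t \<omega>. 0 \<le> t \<Longrightarrow> \<omega> \<in> space M \<Longrightarrow> \<bar>f n t \<omega>\<bar> \<le> C"
    and "\<And>t \<omega>. 0 \<le> t \<Longrightarrow> \<omega> \<in> space M \<Longrightarrow> (\<lambda>n. f n t \<omega>) \<longlonglongrightarrow> g t \<omega>"
  shows "ucp_convergent M (\<lambda>n. J (f n)) (J g)"
proof -
  have "\<forall>f g C. (\<forall>n. predictable M F (f n)) \<longrightarrow> predictable M F g \<longrightarrow>
      (\<forall>n. \<forall>t\<ge>0. \<forall>\<omega>\<in>space M. \<bar>f n t \<omega>\<bar> \<le> C) \<longrightarrow>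
      (\<forall>t\<ge>0. \<forall>\<omega>\<in>space M. (\<lambda>n. f n t \<omega>) \<longlonglongrightarrow> g t \<omega>) \<longrightarrow> ucp_convergent M (\<lambda>n. J (f n)) (J g)"
    using assms(1) unfolding integral_extension_def by (elim conjE)
  from this[rule_format, of f g C] show ?thesis using assms(2-) by simp
qed

lemma bounded_predictable_dyadic_sample:
  assumes "filtration_on M F" "adapted F U" "0 \<le> C"
  shows "bounded_predictable M F (dyadic_sample C U k)"
  unfolding bounded_predictable_def
proof
  show "predictable M F (dyadic_sample C U k)"
    unfolding dyadic_sample_def
    by (intro predictable_simple_process simple_data_dyadic_sample assms)
  show "\<exists>C'. \<forall>t\<ge>0. \<forall>\<omega>\<in>space M. \<bar>dyadic_sample C U k t \<omega>\<bar> \<le> C'"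
    by (intro exI[of _ C] allI impI ballI abs_dyadic_sample_le assms)
qed

lemma integral_extension_dyadic_limit:
  assumes J: "integral_extension M F X J" and F: "filtration_on M F"
    and U: "rcll_process M U" "adapted F U" "predictable M F (left_limit_process U)" and C: "0 \<le> C"
  shows "ucp_convergent M (\<lambda>k. J (dyadic_sample C U k)) (J (\<lambda>t \<omega>. clip C (left_limit_process U t \<omega>)))"
proof (rule integral_extension_bounded_limit[OF J])
  show "predictable M F (dyadic_sample C U k)" for k
    using bounded_predictable_dyadic_sample[OF F U(2) C] by (simp add: bounded_predictable_def)
  show "predictable M F (\<lambda>t \<omega>. clip C (left_limit_process U t \<omega>))"
    by (rule predictable_comp[OF U(3) measurable_clip])
qed (use abs_dyadic_sample_le[OF C] dyadic_sample_tendsto[OF U(1)] C in simp_all)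

lemma integral_extension_clipped_unique:
  assumes M: "prob_space M" and U: "rcll_process M U" and C: "0 \<le> C"
    and F: "filtration_on M F" "adapted F U" "predictable M F (left_limit_process U)"
      "integral_extension M F X J"
    and G: "filtration_on M G" "adapted G U" "predictable M G (left_limit_process U)"
      "integral_extension M G X K"
  defines "f \<equiv> \<lambda>t \<omega>. clip C (left_limit_process U t \<omega>)"
  shows "indistinguishable M (J f) (K f)"
proof -
  let ?D = "dyadic_sample C U"
  have J: "rcll_process M (J f)" "rcll_process M (J (?D k))" for k
    unfolding f_def
    by (intro integral_extension_rcll[OF F(4)] bounded_predictable_clip bounded_predictable_dyadic_sample F C)+
  have K: "rcll_process M (K f)" "rcll_process M (K (?D k))" for k
    unfolding f_def
    by (intro integral_extension_rcll[OF G(4)] bounded_predictable_clip bounded_predictable_dyadic_sample G C)+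
  have same: "indistinguishable M (J (?D k)) (K (?D k))" for k
  proof -
    let ?S = "simple_integral X (k * 2 ^ k) (\<lambda>i. real i / 2 ^ k) (\<lambda>\<omega>. 0)
      (\<lambda>i \<omega>. clip C (U (real i / 2 ^ k) \<omega>))"
    have "indistinguishable M (J (?D k)) ?S"
      unfolding dyadic_sample_def
      by (rule integral_extension_simple[OF F(4) simple_data_dyadic_sample[OF F(2) C]])
    moreover have "indistinguishable M (K (?D k)) ?S"
      unfolding dyadic_sample_def
      by (rule integral_extension_simple[OF G(4) simple_data_dyadic_sample[OF G(2) C]])
    ultimately show ?thesis
      unfolding indistinguishable_def by eventually_elim simp
  qed
  have "ucp_convergent M (\<lambda>k. K (?D k)) (K f)"
    unfolding f_def by (rule integral_extension_dyadic_limit[OF G(4,1) U G(2,3) C])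
  then have "ucp_convergent M (\<lambda>k. J (?D k)) (K f)"
    by (rule ucp_convergent_cong[OF M K(2) K(1) _ same])
  moreover have "ucp_convergent M (\<lambda>k. J (?D k)) (J f)"
    unfolding f_def by (rule integral_extension_dyadic_limit[OF F(4,1) U F(2,3) C])
  ultimately show ?thesis
    by (intro ucp_convergent_unique[OF M J(2) J(1) _ K(1)])
qed

text \<open>
  Clipping at level \<open>m\<close> and cutting off beyond level \<open>m\<close> give processes that agree where
  \<open>|f| \<le> m\<close>, and differ by \<open>\<plusminus> m\<close> elsewhere; so the difference is dominated by \<open>|f|\<close> and at each point
  is eventually \<open>0\<close>.
\<close>

lemma stochastic_integral_clipped_limit:
  assumes M: "prob_space M" and Y: "is_stochastic_integral M F f X Y"
  obtains J where "integral_extension M F X J"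
    and "ucp_convergent M (\<lambda>m. J (\<lambda>t \<omega>. clip (real m) (f t \<omega>))) Y"
proof -
  from Y obtain J where pred: "predictable M F f" and rcll: "rcll_process M Y"
    and J: "integral_extension M F X J"
    and dom: "\<forall>h. (\<forall>n. bounded_predictable M F (h n)) \<longrightarrow>
        (\<forall>n. \<forall>t\<ge>0. \<forall>\<omega>\<in>space M. \<bar>h n t \<omega>\<bar> \<le> \<bar>f t \<omega>\<bar>) \<longrightarrow>
        (\<forall>t\<ge>0. \<forall>\<omega>\<in>space M. (\<lambda>n. h n t \<omega>) \<longlonglongrightarrow> 0) \<longrightarrow> ucp_convergent M (\<lambda>n. J (h n)) (\<lambda>t \<omega>. 0)"
    and lim: "ucp_convergent M (\<lambda>n. J (\<lambda>t \<omega>. if \<bar>f t \<omega>\<bar> \<le> real n then f t \<omega> else 0)) Y"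
    unfolding is_stochastic_integral_def by (elim conjE exE)
  define cut :: "nat \<Rightarrow> real \<Rightarrow> real" where "cut m x = (if \<bar>x\<bar> \<le> real m then x else 0)" for m x
  define rest where "rest m x = clip (real m) x - cut m x" for m x
  have [measurable]: "cut m \<in> borel_measurable borel" for m
    unfolding cut_def by measurable
  have [measurable]: "rest m \<in> borel_measurable borel" for m
    unfolding rest_def by measurable
  have abs_cut: "\<bar>cut m x\<bar> \<le> real m" for m x by (simp add: cut_def)
  have abs_rest: "\<bar>rest m x\<bar> \<le> min \<bar>x\<bar> (real m)" for m x by (auto simp: rest_def cut_def clip_def)
  have bp: "bounded_predictable M F (\<lambda>t \<omega>. cut m (f t \<omega>))" "bounded_predictable M F (\<lambda>t \<omega>. rest m (f t \<omega>))" for m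
    using abs_cut[of m] abs_rest[of m] predictable_comp[OF pred, of "cut m"] predictable_comp[OF pred, of "rest m"]
    by (auto simp: bounded_predictable_def)
  have rest_lim: "(\<lambda>m. rest m x) \<longlonglongrightarrow> 0" for x
  proof (rule tendsto_eventually)
    show "eventually (\<lambda>m. rest m x = 0) sequentially"
      using eventually_ge_at_top[of "nat \<lceil>\<bar>x\<bar>\<rceil>"]
      by eventually_elim (auto simp: nat_ceiling_le_eq rest_def cut_def clip_def)
  qed
  have lim_rest: "ucp_convergent M (\<lambda>m. J (\<lambda>t \<omega>. rest m (f t \<omega>))) (\<lambda>t \<omega>. 0)"
    using abs_rest by (intro dom[rule_format] bp(2) rest_lim) simp
  have lim_cut: "ucp_convergent M (\<lambda>m. J (\<lambda>t \<omega>. cut m (f t \<omega>))) Y"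
    using lim by (simp only: cut_def)
  have split: "indistinguishable M (J (\<lambda>t \<omega>. clip (real m) (f t \<omega>)))
      (\<lambda>t \<omega>. J (\<lambda>t \<omega>. cut m (f t \<omega>)) t \<omega> + J (\<lambda>t \<omega>. rest m (f t \<omega>)) t \<omega>)" for m
    using integral_extension_linear[OF J bp(1) bp(2), of 1 m 1 m] by (simp add: rest_def)
  have "ucp_convergent M (\<lambda>m. J (\<lambda>t \<omega>. clip (real m) (f t \<omega>))) Y"
    by (rule ucp_convergent_indistinguishable_add[OF M integral_extension_rcll[OF J bp(1)] rcll lim_cut
          integral_extension_rcll[OF J bp(2)] lim_rest split])
  then show ?thesis by (rule that[OF J])
qed

theorem proposition1:
  fixes M :: "'a measure" and F G :: "real \<Rightarrow> 'a measure"
    and X U Y Z :: "real \<Rightarrow> 'a \<Rightarrow> real"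
  assumes "prob_space M" and "complete_measure M"
    and "filtration_on M F" and "filtration_on M G"
    and "rcll_process M X"
    and "semimartingale M F X" and "semimartingale M G X"
    and "rcll_process M U"
    and "adapted F U" and "adapted G U"
    and "is_stochastic_integral M F (left_limit_process U) X Y"
    and "is_stochastic_integral M G (left_limit_process U) X Z"
  shows "indistinguishable M Y Z"
proof -
  let ?f = "\<lambda>m t \<omega>. clip (real m) (left_limit_process U t \<omega>)"
  obtain J where J: "integral_extension M F X J" "ucp_convergent M (\<lambda>m. J (?f m)) Y"
    using stochastic_integral_clipped_limit[OF assms(1,11)] .
  obtain K where K: "integral_extension M G X K" "ucp_convergent M (\<lambda>m. K (?f m)) Z"
    using stochastic_integral_clipped_limit[OF assms(1,12)] .
  have pred: "predictable M F (left_limit_process U)" "predictable M G (left_limit_process U)"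
    and rcll: "rcll_process M Y" "rcll_process M Z"
    using assms(11,12) by (auto simp: is_stochastic_integral_def)
  have rcllJ: "rcll_process M (J (?f m))" and rcllK: "rcll_process M (K (?f m))" for m
    by (intro integral_extension_rcll[OF J(1)] integral_extension_rcll[OF K(1)]
        bounded_predictable_clip pred of_nat_0_le_iff)+
  have "indistinguishable M (J (?f m)) (K (?f m))" for m
    by (rule integral_extension_clipped_unique[OF assms(1,8) of_nat_0_le_iff assms(3,9) pred(1) J(1)
          assms(4,10) pred(2) K(1)])
  then have "ucp_convergent M (\<lambda>m. J (?f m)) Z"
    by (rule ucp_convergent_cong[OF assms(1) rcllK rcll(2) K(2)])
  then show ?thesis
    by (rule ucp_convergent_unique[OF assms(1) rcllJ rcll(1) J(2) rcll(2)])
qed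

end
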